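(* For every integer $n \geq 3$ there is a primefree $\mathrm{CK}(n)$-domain; that is, there is an atomic domain having no prime elements and having exactly $n$ atoms up to associates.
   Context: A domain is a commutative ring (with $1 \neq 0$) without zero-divisors. For a domain $R$, let $R^{\times}$ be its unit group and $R^{\circ} = R \setminus (\{0\} \cup R^{\times})$. An element $p \in R^{\circ}$ is prime if the ideal $(p)$ is prime; $p \in R^{\circ}$ is an atom if for all $x,y \in R$, $p = xy$ implies $x \in R^{\times}$ or $y \in R^{\times}$. $R$ is atomic if every $x \in R^{\circ}$ is a finite product of atoms. $R$ is primefree if it has no prime elements. "$R$ has $\kappa$ atoms" means there is a set $\mathcal{P}$ of atoms of $R$ of cardinality $\kappa$ such that every atom of $R$ is associate to a unique $p \in \mathcal{P}$. For $n \in \mathbb{Z}^+$, a $\mathrm{CK}(n)$-domain is an atomic domain with exactly $n$ atoms. *)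

theory Defs
  imports Complex_Main "HOL-Algebra.Algebra"
begin

definition nonzero_nonunits :: "('a, 'b) ring_scheme \<Rightarrow> 'a set" where
  "nonzero_nonunits R = carrier R - ({\<zero>\<^bsub>R\<^esub>} \<union> Units R)"

definition prime_element :: "('a, 'b) ring_scheme \<Rightarrow> 'a \<Rightarrow> bool" where
  "prime_element R p \<longleftrightarrow> p \<in> nonzero_nonunits R \<and> primeideal (PIdl\<^bsub>R\<^esub> p) R"

definition atom :: "('a, 'b) ring_scheme \<Rightarrow> 'a \<Rightarrow> bool" where
  "atom R p \<longleftrightarrow> p \<in> nonzero_nonunits R \<and>
     (\<forall>x\<in>carrier R. \<forall>y\<in>carrier R. p = x \<otimes>\<^bsub>R\<^esub> y \<longrightarrow> x \<in> Units R \<or> y \<in> Units R)"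

definition atomic :: "('a, 'b) ring_scheme \<Rightarrow> bool" where
  "atomic R \<longleftrightarrow> (\<forall>x\<in>nonzero_nonunits R.
     \<exists>ps. (\<forall>p\<in>set ps. atom R p) \<and> x = foldr (\<otimes>\<^bsub>R\<^esub>) ps \<one>\<^bsub>R\<^esub>)"

definition primefree :: "('a, 'b) ring_scheme \<Rightarrow> bool" where
  "primefree R \<longleftrightarrow> \<not> (\<exists>p. prime_element R p)"

definition has_n_atoms :: "('a, 'b) ring_scheme \<Rightarrow> nat \<Rightarrow> bool" where
  "has_n_atoms R n \<longleftrightarrow> (\<exists>P. (\<forall>p\<in>P. atom R p) \<and> finite P \<and> card P = n \<and>
     (\<forall>a. atom R a \<longrightarrow> (\<exists>!p. p \<in> P \<and> a \<sim>\<^bsub>R\<^esub> p)))"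

definition CK_domain :: "nat \<Rightarrow> ('a, 'b) ring_scheme \<Rightarrow> bool" where
  "CK_domain n R \<longleftrightarrow> n \<ge> 1 \<and> domain R \<and> atomic R \<and> has_n_atoms R n"

text \<open>In a domain, these notions agree with those of HOL-Algebra.\<close>

lemma (in domain) atom_iff_ring_irreducible:
  "atom R p \<longleftrightarrow> p \<in> carrier R \<and> ring_irreducible p"
  using ring_irreducibleE[of p] ring_irreducibleI[of p]
  by (auto simp: atom_def nonzero_nonunits_def)

lemma (in domain) prime_element_iff_ring_prime:
  "prime_element R p \<longleftrightarrow> p \<in> carrier R \<and> ring_prime p"
  using primeideal_iff_prime[of p]
  by (auto simp: prime_element_def nonzero_nonunits_def ring_prime_def prime_def)

text \<open>
  HOL cannot quantify existentially over types, so "there is a domain" has to name a type that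
  holds the underlying set. In \<open>R :: complex ring\<close> the carrier may be any set of complex
  numbers and the operations are arbitrary: they need not be those of the complex field, and
  the characteristic need not be 0. Hence, up to isomorphism, \<open>R\<close> ranges over all rings of
  cardinality at most that of the continuum.
\<close>

end

theory Submission
  imports Defs "HOL-Library.Function_Algebras" "HOL-Computational_Algebra.Formal_Laurent_Series"
    "HOL-Algebra.Algebraic_Closure_Type" "Berlekamp_Zassenhaus.Finite_Field"
begin

text \<open>
  Let \<open>k \<subset> L\<close> be finite fields with \<open>m = |L\<^sup>\<times>| / |k\<^sup>\<times>|\<close>. The atoms of the local ring \<open>k + X L[[X]]\<close>
  are the series of order 1; up to associates they are classified by the class of the leading
  coefficient in \<open>L\<^sup>\<times> / k\<^sup>\<times>\<close>, so there are \<open>m\<close> of them, and none is prime if \<open>m > 1\<close>. If a field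
  \<open>K\<close> is embedded into finitely many fields \<open>L\<^sub>i((X))\<close> and contains elements with prescribed leading
  terms, the elements of \<open>K\<close> that lie in \<open>k\<^sub>i + X L\<^sub>i[[X]]\<close> for all \<open>i\<close> form a primefree atomic domain
  with \<open>\<Sum> m\<^sub>i\<close> atoms. Such a \<open>K\<close> is built without any approximation theorem: start with the prime
  field and successively adjoin families of Laurent series with the required leading terms whose
  components are transcendental. These exist because \<open>K\<close> stays countable, while there are
  uncountably many series with a given leading term.

  In characteristic 2 the pairs \<open>F\<^sub>2 \<subset> F\<^sub>4\<close>, \<open>F\<^sub>4 \<subset> F\<^sub>1\<^sub>6\<close>, \<open>F\<^sub>2 \<subset> F\<^sub>8\<close> give \<open>m = 3, 5, 7\<close>, hence
  all \<open>n \<ge> 3\<close> except 4, and \<open>F\<^sub>3 \<subset> F\<^sub>9\<close> gives \<open>m = 4\<close>.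
\<close>

section \<open>Domains with finitely many places\<close>

text \<open>\<open>v i\<close> is the order at the place \<open>i\<close>, and \<open>l i\<close> is the class of the leading coefficient
  in the group \<open>G i = L\<^sub>i\<^sup>\<times> / k\<^sub>i\<^sup>\<times>\<close>.\<close>

locale graded_residues = domain R for R (structure) +
  fixes I :: "'i set" and v :: "'i \<Rightarrow> 'a \<Rightarrow> nat" and l :: "'i \<Rightarrow> 'a \<Rightarrow> 'g::comm_monoid_mult"
    and G :: "'i \<Rightarrow> 'g set"
  assumes finite_places: "finite I"
    and places_nonempty: "I \<noteq> {}"
    and finite_residues: "\<And>i. i \<in> I \<Longrightarrow> finite (G i)"
    and two_residues: "\<And>i. i \<in> I \<Longrightarrow> card (G i) \<ge> 2"
    and v_mult: "\<And>i a b. \<lbrakk>i \<in> I; a \<in> carrier R - {\<zero>}; b \<in> carrier R - {\<zero>}\<rbrakk> \<Longrightarrow>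
        v i (a \<otimes> b) = v i a + v i b"
    and l_mult: "\<And>i a b. \<lbrakk>i \<in> I; a \<in> carrier R - {\<zero>}; b \<in> carrier R - {\<zero>}\<rbrakk> \<Longrightarrow>
        l i (a \<otimes> b) = l i a * l i b"
    and l_mem: "\<And>i a. \<lbrakk>i \<in> I; a \<in> carrier R - {\<zero>}\<rbrakk> \<Longrightarrow> l i a \<in> G i"
    and l_eq_1: "\<And>i a. \<lbrakk>i \<in> I; a \<in> carrier R - {\<zero>}; v i a = 0\<rbrakk> \<Longrightarrow> l i a = 1"
    and divisible: "\<And>a b. \<lbrakk>a \<in> carrier R - {\<zero>}; b \<in> carrier R - {\<zero>};
        \<And>i. i \<in> I \<Longrightarrow> v i b < v i a \<or> v i a = v i b \<and> l i a = l i b\<rbrakk> \<Longrightarrow> \<exists>c\<in>carrier R. a = b \<otimes> c"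
    and ex_uniformizer: "\<And>i g. \<lbrakk>i \<in> I; g \<in> G i\<rbrakk> \<Longrightarrow>
        \<exists>p\<in>carrier R - {\<zero>}. v i p = 1 \<and> l i p = g \<and> (\<forall>j\<in>I - {i}. v j p = 0)"
begin

text \<open>This is the factorization length: it is additive, vanishes exactly on units and equals 1
  exactly on atoms.\<close>

definition total :: "'a \<Rightarrow> nat" where
  "total a = (\<Sum>i\<in>I. v i a)"

lemma total_mult:
  "\<lbrakk>a \<in> carrier R - {\<zero>}; b \<in> carrier R - {\<zero>}\<rbrakk> \<Longrightarrow> total (a \<otimes> b) = total a + total b"
  by (simp add: total_def v_mult sum.distrib)

lemma total_eq_0_iff: "total a = 0 \<longleftrightarrow> (\<forall>i\<in>I. v i a = 0)"
  using finite_places by (simp add: total_def)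

lemma total_eq_1_iff:
  "total a = 1 \<longleftrightarrow> (\<exists>i\<in>I. v i a = 1 \<and> (\<forall>j\<in>I - {i}. v j a = 0))"
  unfolding total_def sum_eq_1_iff[OF finite_places] by (intro bex_cong refl) auto

lemma mult_nonzero:
  "\<lbrakk>a \<in> carrier R - {\<zero>}; b \<in> carrier R - {\<zero>}\<rbrakk> \<Longrightarrow> a \<otimes> b \<in> carrier R - {\<zero>}"
  using integral by auto

text \<open>Additivity forces the orders of a unit to be 0. Conversely, order 0 everywhere forces
  all classes to be 1, so the data of \<open>a\<close> and \<open>\<one>\<close> agree and
  \<open>divisible\<close> yields an inverse.\<close>

lemma Units_iff: "a \<in> Units R \<longleftrightarrow> a \<in> carrier R - {\<zero>} \<and> total a = 0"
proof
  assume a: "a \<in> Units R"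
  then have "a \<otimes> inv a = \<one>" "a \<in> carrier R" "inv a \<in> carrier R"
    by auto
  then have nz: "a \<in> carrier R - {\<zero>}" "inv a \<in> carrier R - {\<zero>}"
    using zero_not_one by auto
  have one: "\<one> \<in> carrier R - {\<zero>}"
    using zero_not_one by simp
  have "total \<one> = 0"
    using total_mult[OF one one] by simp
  then show "a \<in> carrier R - {\<zero>} \<and> total a = 0"
    using total_mult[OF nz] a nz by simp
next
  assume a: "a \<in> carrier R - {\<zero>} \<and> total a = 0"
  have one: "\<one> \<in> carrier R - {\<zero>}"
    using zero_not_one by simp
  have "total \<one> = 0"
    using total_mult[OF one one] by simp
  then have "\<exists>c\<in>carrier R. \<one> = a \<otimes> c"
    using a one l_eq_1 by (intro divisible) (auto simp: total_eq_0_iff)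
  then show "a \<in> Units R"
    using a m_comm by (auto simp: Units_def)
qed

lemma nonzero_nonunits_iff:
  "a \<in> nonzero_nonunits R \<longleftrightarrow> a \<in> carrier R - {\<zero>} \<and> total a > 0"
  by (auto simp: nonzero_nonunits_def Units_iff)

text \<open>The divisor is a uniformizer at a place where \<open>a\<close> has positive order,
  chosen with the class of \<open>a\<close> there. This matters when that order is exactly 1; a
  larger order allows any class.\<close>

lemma split_uniformizer:
  assumes "a \<in> carrier R - {\<zero>}" "total a > 0"
  obtains p c where "p \<in> carrier R - {\<zero>}" "total p = 1" "c \<in> carrier R - {\<zero>}" "a = p \<otimes> c"
proof -
  obtain i where i: "i \<in> I" "v i a > 0"
    using assms(2) total_eq_0_iff[of a] by auto
  obtain p where p: "p \<in> carrier R - {\<zero>}" "v i p = 1" "l i p = l i a"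
      "\<forall>j\<in>I - {i}. v j p = 0"
    using ex_uniformizer[OF i(1) l_mem[OF i(1) assms(1)]] by auto
  have "\<exists>c\<in>carrier R. a = p \<otimes> c"
  proof (rule divisible[OF assms(1) p(1)])
    fix j assume "j \<in> I"
    then show "v j p < v j a \<or> v j a = v j p \<and> l j a = l j p"
      using p i assms(1) l_eq_1 by (cases "j = i"; cases "v j a = 0") auto
  qed
  then obtain c where c: "c \<in> carrier R" "a = p \<otimes> c"
    by auto
  moreover have "c \<noteq> \<zero>"
    using c p(1) assms(1) by auto
  moreover have "total p = 1"
    using i p by (auto simp only: total_eq_1_iff)
  ultimately show ?thesis
    using that p(1) by auto
qed

text \<open>An atom must coincide, up to a unit, with the element of total 1 that splits off from
  it; conversely, a total of 1 cannot be shared by two nonunits.\<close>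

lemma atom_iff: "atom R a \<longleftrightarrow> a \<in> carrier R - {\<zero>} \<and> total a = 1"
proof
  assume a: "atom R a"
  then have nz: "a \<in> carrier R - {\<zero>}" "total a > 0"
    by (auto simp: atom_def nonzero_nonunits_iff)
  obtain p c where pc: "p \<in> carrier R - {\<zero>}" "total p = 1" "c \<in> carrier R - {\<zero>}" "a = p \<otimes> c"
    by (rule split_uniformizer[OF nz])
  then have "p \<in> Units R \<or> c \<in> Units R"
    using a unfolding atom_def by blast
  then have "c \<in> Units R"
    using pc(2) by (simp add: Units_iff)
  then show "a \<in> carrier R - {\<zero>} \<and> total a = 1"
    using pc nz total_mult[of p c] Units_iff[of c] by simp
next
  assume a: "a \<in> carrier R - {\<zero>} \<and> total a = 1"
  have "x \<in> Units R \<or> y \<in> Units R" if xy: "x \<in> carrier R" "y \<in> carrier R" "a = x \<otimes> y" for x y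
  proof -
    have "x \<in> carrier R - {\<zero>}" "y \<in> carrier R - {\<zero>}"
      using a xy by auto
    then show ?thesis
      using total_mult[of x y] a xy(3) by (auto simp: Units_iff)
  qed
  then show "atom R a"
    using a by (auto simp: atom_def nonzero_nonunits_iff)
qed

lemma atomic: "atomic R"
proof -
  have "\<exists>ps. (\<forall>p\<in>set ps. atom R p) \<and> a = foldr (\<otimes>) ps \<one>"
    if "a \<in> carrier R - {\<zero>}" "total a = Suc n" for a n
    using that
  proof (induction n arbitrary: a)
    case 0
    then show ?case
      by (intro exI[of _ "[a]"]) (auto simp: atom_iff)
  next
    case (Suc n)
    then obtain p c where pc: "p \<in> carrier R - {\<zero>}" "total p = 1" "c \<in> carrier R - {\<zero>}" "a = p \<otimes> c"
      using split_uniformizer[of a] by auto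
    then have "total c = Suc n"
      using Suc.prems total_mult[of p c] by simp
    then obtain ps where "\<forall>p\<in>set ps. atom R p" "c = foldr (\<otimes>) ps \<one>"
      using Suc.IH[OF pc(3)] by auto
    then show ?case
      using pc by (intro exI[of _ "p # ps"]) (auto simp: atom_iff)
  qed
  note factorization = this
  show ?thesis
    unfolding atomic_def
  proof
    fix a assume "a \<in> nonzero_nonunits R"
    then show "\<exists>ps. (\<forall>p\<in>set ps. atom R p) \<and> a = foldr (\<otimes>) ps \<one>"
      using factorization[of a "total a - 1"] by (simp add: nonzero_nonunits_iff)
  qed
qed

section \<open>Associate classes and the number of atoms\<close>

lemma associated_imp:
  assumes "a \<in> carrier R - {\<zero>}" "b \<in> carrier R - {\<zero>}" "a \<sim> b" "i \<in> I"
  shows "v i a = v i b \<and> l i a = l i b"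
proof -
  obtain u where u: "u \<in> Units R" "a = u \<otimes> b"
    using ring_associated_iff[of a b] assms(1-3) by blast
  then have "u \<in> carrier R - {\<zero>}" "v i u = 0"
    using assms(4) by (simp_all add: Units_iff total_eq_0_iff)
  then show ?thesis
    using u(2) assms(4) l_eq_1[of i u] v_mult[of i u b] l_mult[of i u b] assms(2) by simp
qed

text \<open>Equal data allow division in both directions. With \<open>associated_imp\<close>, the
  orders and classes form a complete invariant up to associates.\<close>

lemma associatedI':
  assumes "a \<in> carrier R - {\<zero>}" "b \<in> carrier R - {\<zero>}"
    and "\<And>i. i \<in> I \<Longrightarrow> v i a = v i b \<and> l i a = l i b"
  shows "a \<sim> b"
proof -
  have "\<exists>c\<in>carrier R. a = b \<otimes> c" "\<exists>c\<in>carrier R. b = a \<otimes> c"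
    by (rule divisible[OF assms(1,2)] divisible[OF assms(2,1)]; simp add: assms(3))+
  then show ?thesis
    unfolding associated_def factor_def by blast
qed

text \<open>An atom has order 1 at a single place and order 0, hence class 1, at all others. Its
  associate class therefore amounts to that place and the class there, and \<open>\<pi> i g\<close>
  is a representative.\<close>

lemma has_n_atoms: "has_n_atoms R (\<Sum>i\<in>I. card (G i))"
proof -
  obtain \<pi> where \<pi>: "\<And>i g. \<lbrakk>i \<in> I; g \<in> G i\<rbrakk> \<Longrightarrow>
      \<pi> i g \<in> carrier R - {\<zero>} \<and> v i (\<pi> i g) = 1 \<and> l i (\<pi> i g) = g \<and> (\<forall>j\<in>I - {i}. v j (\<pi> i g) = 0)"
    using ex_uniformizer by metis
  have place: "i = j" if "i \<in> I" "g \<in> G i" "j \<in> I" "v j (\<pi> i g) = 1" for i j g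
    using \<pi>[of i g] that by (cases "i = j") auto
  define P where "P = (\<lambda>(i, g). \<pi> i g) ` Sigma I G"
  have "inj_on (\<lambda>(i, g). \<pi> i g) (Sigma I G)"
  proof (rule inj_onI, clarify)
    fix i g j h
    assume *: "i \<in> I" "g \<in> G i" "j \<in> I" "h \<in> G j" "\<pi> i g = \<pi> j h"
    then have "l i (\<pi> i g) = g" "v j (\<pi> i g) = 1" "l j (\<pi> i g) = h"
      using \<pi> by metis+
    moreover from this have "i = j"
      using place * by blast
    ultimately show "i = j \<and> g = h"
      by simp
  qed
  then have "card P = (\<Sum>i\<in>I. card (G i))"
    using finite_places finite_residues by (simp add: P_def card_image card_SigmaI)
  moreover have "finite P"
    using finite_places finite_residues by (auto simp: P_def)
  moreover have "atom R p" if "p \<in> P" for p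
  proof -
    from that obtain i g where ig: "i \<in> I" "g \<in> G i" "p = \<pi> i g"
      by (auto simp: P_def)
    then show ?thesis
      using \<pi>[OF ig(1,2)] ig(1) unfolding atom_iff total_eq_1_iff ig(3) by blast
  qed
  moreover have "\<exists>!p. p \<in> P \<and> a \<sim> p" if "atom R a" for a
  proof -
    from that obtain i where i: "i \<in> I" "v i a = 1" "\<forall>j\<in>I - {i}. v j a = 0"
      and a: "a \<in> carrier R - {\<zero>}"
      unfolding atom_iff total_eq_1_iff by blast
    define g where "g = l i a"
    have g: "g \<in> G i"
      using a i l_mem by (simp add: g_def)
    show ?thesis
    proof (rule ex1I[of _ "\<pi> i g"])
      have "v j a = v j (\<pi> i g) \<and> l j a = l j (\<pi> i g)" if "j \<in> I" for j
        using \<pi>[OF i(1) g] a i that l_eq_1[of j a] l_eq_1[of j "\<pi> i g"]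
        by (cases "j = i") (auto simp: g_def)
      then have "a \<sim> \<pi> i g"
        using \<pi>[OF i(1) g] a by (intro associatedI') auto
      then show "\<pi> i g \<in> P \<and> a \<sim> \<pi> i g"
        using i(1) g by (auto simp: P_def)
    next
      fix p assume p: "p \<in> P \<and> a \<sim> p"
      then obtain j h where jh: "j \<in> I" "h \<in> G j" "p = \<pi> j h"
        by (auto simp: P_def)
      have "v i (\<pi> j h) = 1 \<and> l i (\<pi> j h) = g"
        using associated_imp[of a "\<pi> j h" i] \<pi>[OF jh(1,2)] p jh a i by (simp add: g_def)
      then show "p = \<pi> i g"
        using place[of j h i] conjunct1[OF conjunct2[OF conjunct2[OF \<pi>[OF jh(1,2)]]]] jh i(1)
        by simp
    qed
  qed
  ultimately show ?thesis
    unfolding has_n_atoms_def by (intro exI[of _ P]) auto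
qed

text \<open>Two atoms at the same place with different residue classes divide each other's squares,
  but not each other.\<close>

lemma primefree: "primefree R"
  unfolding primefree_def
proof
  assume "\<exists>p. prime_element R p"
  then obtain p where "prime_element R p"
    by blast
  then have prime: "p \<in> carrier R" "ring_prime p"
    by (auto simp: prime_element_iff_ring_prime)
  then have "atom R p"
    using mult_of.prime_irreducible ring_primeE ring_irreducibleI'
    by (simp add: atom_iff_ring_irreducible)
  then obtain i where i: "i \<in> I" "v i p = 1" "\<forall>j\<in>I - {i}. v j p = 0"
    and p: "p \<in> carrier R - {\<zero>}"
    unfolding atom_iff total_eq_1_iff by blast
  have "\<not> G i \<subseteq> {l i p}"
    using two_residues[OF i(1)] card_mono[of "{l i p}" "G i"] by auto
  then obtain g where g: "g \<in> G i" "g \<noteq> l i p"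
    by blast
  obtain r where r: "r \<in> carrier R - {\<zero>}" "v i r = 1" "l i r = g" "\<forall>j\<in>I - {i}. v j r = 0"
    using ex_uniformizer[OF i(1) g(1)] by blast
  have rr: "r \<otimes> r \<in> carrier R - {\<zero>}"
    using mult_nonzero r(1) by blast
  have "\<exists>c\<in>carrier R. r \<otimes> r = p \<otimes> c"
  proof (rule divisible[OF rr p])
    fix j assume j: "j \<in> I"
    show "v j p < v j (r \<otimes> r) \<or> v j (r \<otimes> r) = v j p \<and> l j (r \<otimes> r) = l j p"
      using i r p rr j v_mult[of j r r] l_eq_1[of j "r \<otimes> r"] l_eq_1[of j p]
      by (cases "j = i") auto
  qed
  then have "p divides r \<otimes> r"
    unfolding factor_def by auto
  then have "p divides r"
    using ring_primeE(3)[OF prime] r(1) unfolding Divisibility.prime_def by blast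
  then obtain c where c: "c \<in> carrier R" "r = p \<otimes> c"
    unfolding factor_def by auto
  then have cz: "c \<in> carrier R - {\<zero>}"
    using r(1) p by auto
  have "v i c = 0"
    using v_mult[OF i(1) p cz] c r i by simp
  then have "l i r = l i p"
    using l_mult[OF i(1) p cz] l_eq_1[OF i(1) cz] c by simp
  then show False
    using g r by simp
qed

theorem CK_domain_primefree: "CK_domain (\<Sum>i\<in>I. card (G i)) R \<and> primefree R"
proof -
  obtain i where "i \<in> I"
    using places_nonempty by blast
  then have "1 \<le> (\<Sum>i\<in>I. card (G i))"
    using two_residues[of i] member_le_sum[of i I "\<lambda>i. card (G i)"] finite_places by simp
  then show ?thesis
    using domain_axioms atomic has_n_atoms primefree by (simp add: CK_domain_def)
qed

end

text \<open>The order constructed below consists of families of Laurent series, while the final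
  claim asks for a ring on complex numbers; the data move along the inverse of
  \<open>h\<close>.\<close>

lemma (in graded_residues) CK_domain_primefree_image_ring:
  assumes h: "inj_on h (carrier R)"
  shows "CK_domain (\<Sum>i\<in>I. card (G i)) (image_ring h R) \<and> primefree (image_ring h R)"
proof -
  let ?S = "image_ring h R"
  define g where "g = inv_into (carrier R) h"
  have gh: "g (h x) = x" if "x \<in> carrier R" for x
    using that h by (simp add: g_def)
  have S: "carrier ?S = h ` carrier R" "\<zero>\<^bsub>?S\<^esub> = h \<zero>" "x \<otimes>\<^bsub>?S\<^esub> y = h (g x \<otimes> g y)" for x y
    by (simp_all add: image_ring_def image_group_def monoid.defs g_def)
  have E: "\<exists>x'\<in>carrier R - {\<zero>}. x = h x'" if "x \<in> carrier ?S - {\<zero>\<^bsub>?S\<^esub>}" for x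
    using that by (auto simp: S)
  have nz: "h x \<in> carrier ?S - {\<zero>\<^bsub>?S\<^esub>}" if "x \<in> carrier R - {\<zero>}" for x
    using that h by (auto simp: S inj_on_eq_iff)
  interpret S: domain ?S
    by (rule inj_imp_image_ring_is_domain[OF h])
  interpret S: graded_residues ?S I "\<lambda>i. v i \<circ> g" "\<lambda>i. l i \<circ> g" G
  \<comment> \<open>Cases 5 to 10 are \<open>v_mult\<close>, \<open>l_mult\<close>,
    \<open>l_mem\<close>, \<open>l_eq_1\<close>, \<open>divisible\<close> and
    \<open>ex_uniformizer\<close>.\<close>
  proof (unfold_locales, goal_cases)
    case (5 i a b)
    obtain a' b' where ab: "a' \<in> carrier R - {\<zero>}" "a = h a'" "b' \<in> carrier R - {\<zero>}" "b = h b'"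
      using 5 E by metis
    then show ?case
      using v_mult[OF 5(1) ab(1,3)] by (simp add: S gh)
  next
    case (6 i a b)
    obtain a' b' where ab: "a' \<in> carrier R - {\<zero>}" "a = h a'" "b' \<in> carrier R - {\<zero>}" "b = h b'"
      using 6 E by metis
    then show ?case
      using l_mult[OF 6(1) ab(1,3)] by (simp add: S gh)
  next
    case (7 i a)
    obtain a' where a: "a' \<in> carrier R - {\<zero>}" "a = h a'"
      using 7 E by metis
    then show ?case
      using l_mem[OF 7(1) a(1)] by (simp add: gh)
  next
    case (8 i a)
    obtain a' where a: "a' \<in> carrier R - {\<zero>}" "a = h a'"
      using 8 E by metis
    then show ?case
      using l_eq_1[OF 8(1) a(1)] 8(3) by (simp add: gh)
  next
    case (9 a b)
    obtain a' b' where ab: "a' \<in> carrier R - {\<zero>}" "a = h a'" "b' \<in> carrier R - {\<zero>}" "b = h b'"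
      using 9 E by metis
    then have "\<exists>c\<in>carrier R. a' = b' \<otimes> c"
      using 9(3) by (intro divisible) (auto simp: gh)
    then obtain c where "c \<in> carrier R" "a' = b' \<otimes> c"
      by blast
    then show ?case
      using ab by (intro bexI[of _ "h c"]) (simp_all add: S gh)
  next
    case (10 i r)
    obtain p where "p \<in> carrier R - {\<zero>}" "v i p = 1 \<and> l i p = r \<and> (\<forall>j\<in>I - {i}. v j p = 0)"
      using ex_uniformizer[OF 10] by blast
    then show ?case
      using nz[of p] by (intro bexI[of _ "h p"]) (simp_all add: gh)
  qed (use finite_places places_nonempty finite_residues two_residues in auto)
  show ?thesis
    by (rule S.CK_domain_primefree)
qed

section \<open>Fields with prescribed leading terms\<close>

unbundle fps_syntax

section \<open>Subfields and Laurent series with coefficients in them\<close>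

definition is_subfield :: "'a::field set \<Rightarrow> bool" where
  "is_subfield S \<longleftrightarrow> 0 \<in> S \<and> 1 \<in> S \<and> (\<forall>x\<in>S. \<forall>y\<in>S. x - y \<in> S \<and> x * y \<in> S) \<and> (\<forall>x\<in>S. inverse x \<in> S)"

lemma is_subfieldD:
  assumes "is_subfield S"
  shows "0 \<in> S" "1 \<in> S" "\<lbrakk>x \<in> S; y \<in> S\<rbrakk> \<Longrightarrow> x - y \<in> S" "\<lbrakk>x \<in> S; y \<in> S\<rbrakk> \<Longrightarrow> x * y \<in> S"
    "x \<in> S \<Longrightarrow> inverse x \<in> S" "x \<in> S \<Longrightarrow> - x \<in> S" "\<lbrakk>x \<in> S; y \<in> S\<rbrakk> \<Longrightarrow> x + y \<in> S"
    "\<lbrakk>x \<in> S; y \<in> S\<rbrakk> \<Longrightarrow> x / y \<in> S"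
proof -
  show S: "0 \<in> S" "1 \<in> S" "\<lbrakk>x \<in> S; y \<in> S\<rbrakk> \<Longrightarrow> x - y \<in> S" "\<lbrakk>x \<in> S; y \<in> S\<rbrakk> \<Longrightarrow> x * y \<in> S"
    "x \<in> S \<Longrightarrow> inverse x \<in> S" for x y
    using assms by (auto simp: is_subfield_def)
  show m: "x \<in> S \<Longrightarrow> - x \<in> S" for x
    using S(3)[of 0 x] S(1) by simp
  show "\<lbrakk>x \<in> S; y \<in> S\<rbrakk> \<Longrightarrow> x + y \<in> S"
    using S(3)[of x "- y"] m[of y] by simp
  show "\<lbrakk>x \<in> S; y \<in> S\<rbrakk> \<Longrightarrow> x / y \<in> S"
    using S(4)[of x "inverse y"] S(5)[of y] by (simp add: divide_inverse)
qed

lemma sum_in_subfield: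
  assumes "is_subfield S" "\<And>x. x \<in> A \<Longrightarrow> f x \<in> S"
  shows "sum f A \<in> S"
  using assms(2)
  by (induction A rule: infinite_finite_induct) (auto simp: is_subfieldD[OF assms(1)])

text \<open>The field S((X)) as a subset of the Laurent series over an ambient field, so that
  different coefficient fields \<open>L i\<close> can share one type.\<close>

definition laurent_over :: "'a::field set \<Rightarrow> 'a fls set" where
  "laurent_over S = {f. \<forall>n. f $$ n \<in> S}"

text \<open>The recursion for the coefficients of the inverse uses only field operations on
  coefficients of \<open>f\<close> and earlier results.\<close>

lemma fps_inverse_nth_in_subfield:
  assumes "is_subfield S" "\<And>n. fps_nth f n \<in> S"
  shows "fps_nth (inverse f) n \<in> S"
proof (induction n rule: less_induct)
  case (less n)
  show ?case
  proof (cases n)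
    case 0
    then show ?thesis
      using assms by (simp add: fps_inverse_def is_subfieldD)
  next
    case (Suc m)
    have "fps_nth f i * natfun_inverse f (n - i) \<in> S" if "i \<in> {1..n}" for i
      using less[of "n - i"] that assms by (auto simp: fps_inverse_def intro: is_subfieldD)
    then have "(\<Sum>i\<in>{1..n}. fps_nth f i * natfun_inverse f (n - i)) \<in> S"
      by (rule sum_in_subfield[OF assms(1)])
    then have "- inverse (fps_nth f 0) * (\<Sum>i\<in>{1..n}. fps_nth f i * natfun_inverse f (n - i)) \<in> S"
      using assms by (intro is_subfieldD(4-6)[OF assms(1)])
    then show ?thesis
      using Suc by (simp add: fps_inverse_def)
  qed
qed

text \<open>Coefficients of products are finite sums of products, and inversion reduces to power
  series by splitting off a power of X.\<close>

lemma is_subfield_laurent_over: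
  assumes "is_subfield S"
  shows "is_subfield (laurent_over S)"
proof -
  note S = is_subfieldD[OF assms]
  have "inverse f $$ n \<in> S" if f: "\<forall>n. f $$ n \<in> S" for f n
  proof (cases "f = 0")
    case False
    have "fps_nth (inverse (fls_base_factor_to_fps f)) m \<in> S" for m
      using f by (intro fps_inverse_nth_in_subfield[OF assms]) simp
    then show ?thesis
      using S(1) by (simp add: fls_inverse_def)
  qed (simp add: S)
  moreover have "(f * g) $$ n \<in> S" if "\<forall>n. f $$ n \<in> S" "\<forall>n. g $$ n \<in> S" for f g n
    using that S unfolding fls_times_nth(2) by (intro sum_in_subfield[OF assms]) auto
  ultimately show ?thesis
    unfolding is_subfield_def laurent_over_def using S by simp
qed

section \<open>Embedded fields and the adjunction of transcendental families\<close>

text \<open>A family of embeddings of one countable field into the fields \<^term>\<open>E i\<close>, encoded as the set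
  of the families of images of its elements.\<close>

definition embedded_field :: "('i \<Rightarrow> 'b::field set) \<Rightarrow> ('i \<Rightarrow> 'b) set \<Rightarrow> bool" where
  "embedded_field E K \<longleftrightarrow> countable K \<and> 0 \<in> K \<and> 1 \<in> K \<and> (\<forall>f\<in>K. \<forall>g\<in>K. f - g \<in> K \<and> f * g \<in> K) \<and>
     (\<forall>f\<in>K. f \<noteq> 0 \<longrightarrow> (\<forall>i. f i \<noteq> 0) \<and> (\<lambda>i. inverse (f i)) \<in> K) \<and> (\<forall>f\<in>K. \<forall>i. f i \<in> E i)"

lemma embedded_fieldD:
  assumes "embedded_field E K"
  shows "countable K" "0 \<in> K" "1 \<in> K"
    "\<lbrakk>f \<in> K; g \<in> K\<rbrakk> \<Longrightarrow> f - g \<in> K" "\<lbrakk>f \<in> K; g \<in> K\<rbrakk> \<Longrightarrow> f * g \<in> K" "\<lbrakk>f \<in> K; g \<in> K\<rbrakk> \<Longrightarrow> f + g \<in> K"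
    "\<lbrakk>f \<in> K; f \<noteq> 0\<rbrakk> \<Longrightarrow> f i \<noteq> 0" "\<lbrakk>f \<in> K; f \<noteq> 0\<rbrakk> \<Longrightarrow> (\<lambda>i. inverse (f i)) \<in> K" "f \<in> K \<Longrightarrow> f i \<in> E i"
proof -
  show "countable K" "0 \<in> K" "1 \<in> K"
    "\<lbrakk>f \<in> K; g \<in> K\<rbrakk> \<Longrightarrow> f * g \<in> K"
    "\<lbrakk>f \<in> K; f \<noteq> 0\<rbrakk> \<Longrightarrow> f i \<noteq> 0" "\<lbrakk>f \<in> K; f \<noteq> 0\<rbrakk> \<Longrightarrow> (\<lambda>i. inverse (f i)) \<in> K" "f \<in> K \<Longrightarrow> f i \<in> E i"
    using assms unfolding embedded_field_def by blast+
  show d: "\<lbrakk>f \<in> K; g \<in> K\<rbrakk> \<Longrightarrow> f - g \<in> K" for f g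
    using assms unfolding embedded_field_def by blast
  show "f + g \<in> K" if "f \<in> K" "g \<in> K"
    using d[OF that(1) d[OF \<open>0 \<in> K\<close> that(2)]] by simp
qed

lemma poly_fun_apply:
  "poly p z i = poly (map_poly (\<lambda>c. c i) p) (z i)" for z :: "'i \<Rightarrow> 'b::comm_ring_1"
proof (induction p)
  case (pCons a p)
  then show ?case
    by (simp add: map_poly_pCons)
qed simp

lemma countable_polys:
  assumes "countable C"
  shows "countable {p :: 'a::zero poly. \<forall>n. Polynomial.coeff p n \<in> C}"
proof (rule countable_subset)
  show "{p. \<forall>n. Polynomial.coeff p n \<in> C} \<subseteq> Poly ` lists C"
  proof
    fix p :: "'a poly" assume "p \<in> {p. \<forall>n. Polynomial.coeff p n \<in> C}"
    then have "Polynomial.coeffs p \<in> lists C"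
      by (auto simp: Polynomial.coeffs_def)
    then show "p \<in> Poly ` lists C"
      by (intro image_eqI[of _ _ "Polynomial.coeffs p"]) simp_all
  qed
  show "countable (Poly ` lists C)"
    using assms by simp
qed

text \<open>The extension is K(z), built from fractions of polynomials evaluated at
  \<open>z\<close>. The ambient ring of families has zero divisors, so the point is that
  transcendence in every component keeps all nonzero denominators away from 0 everywhere.\<close>

lemma adjoin_transcendental:
  fixes z :: "'i \<Rightarrow> 'b::field"
  assumes K: "embedded_field E K" and E: "\<And>i. is_subfield (E i)" and z: "\<And>i. z i \<in> E i"
    and trans: "\<And>i p. \<lbrakk>p \<noteq> 0; \<forall>n. Polynomial.coeff p n \<in> (\<lambda>f. f i) ` K\<rbrakk> \<Longrightarrow> poly p (z i) \<noteq> 0"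
  obtains K' where "embedded_field E K'" "K \<subseteq> K'" "z \<in> K'"
proof -
  note KD = embedded_fieldD[OF K]
  define P where "P = {p. (\<forall>n. Polynomial.coeff p n \<in> K)}"
  have P_iff: "p \<in> P \<longleftrightarrow> (\<forall>n. Polynomial.coeff p n \<in> K)" for p
    by (simp add: P_def)
  have K_sum: "sum f A \<in> K" if "\<And>x. x \<in> A \<Longrightarrow> f x \<in> K" for f :: "nat \<Rightarrow> _" and A
    using that by (induction A rule: infinite_finite_induct) (auto simp: KD(2,6))
  have P_mult: "p * q \<in> P" if "p \<in> P" "q \<in> P" for p q
    using that KD(5) by (auto simp: P_iff coeff_mult intro!: K_sum)
  have P_diff: "p - q \<in> P" if "p \<in> P" "q \<in> P" for p q
    using that KD(4) by (auto simp: P_iff)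
  \<comment> \<open>A nonzero leading coefficient in \<open>K\<close> has no zero component, so the
    projection of \<open>p\<close> to the component \<open>i\<close> stays nonzero and
    \<open>trans\<close> applies to it.\<close>
  have P_nonzero: "poly p z i \<noteq> 0" if "p \<in> P" "p \<noteq> 0" for p i
  proof -
    let ?q = "map_poly (\<lambda>c. c i) p"
    have "Polynomial.lead_coeff p i \<noteq> 0"
      using that KD(7) by (simp add: P_iff)
    then have "Polynomial.coeff ?q (Polynomial.degree p) \<noteq> 0"
      by (simp add: coeff_map_poly)
    then have "?q \<noteq> 0"
      by auto
    moreover have "\<forall>n. Polynomial.coeff ?q n \<in> (\<lambda>f. f i) ` K"
      using that(1) by (simp add: P_iff coeff_map_poly)
    ultimately show ?thesis
      using trans by (simp add: poly_fun_apply)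
  qed
  \<comment> \<open>Polynomials over a ring with zero divisors may multiply to 0; evaluation at
    \<open>z\<close> in a single component rules this out for \<open>P\<close>.\<close>
  have P_mult_nonzero: "p * q \<noteq> 0" if "p \<in> P" "q \<in> P" "p \<noteq> 0" "q \<noteq> 0" for p q
  proof
    assume "p * q = 0"
    then have "poly p z i * poly q z i = 0" for i
      by (metis poly_0 poly_mult times_fun_apply zero_fun_apply)
    then show False
      using P_nonzero that by (metis mult_eq_0_iff)
  qed
  have P_E: "poly p z i \<in> E i" if "p \<in> P" for p i
  proof -
    have "\<forall>n. Polynomial.coeff p n \<in> K"
      using that by (simp add: P_def)
    then show ?thesis
    proof (induction p)
      case (pCons a p)
      have "a \<in> K" "\<forall>n. Polynomial.coeff p n \<in> K"
        using pCons.prems coeff_pCons_0[of a p] coeff_pCons_Suc[of a p] by metis+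
      then show ?case
        using KD(9)[of a i] z[of i] pCons.IH by (simp add: is_subfieldD[OF E])
    qed (simp add: is_subfieldD[OF E])
  qed
  define frac where "frac = (\<lambda>(p, q) i. poly p z i / poly q z i)"
  define K' where "K' = frac ` (P \<times> (P - {0}))"
  have K'I: "f \<in> K'" if "p \<in> P" "q \<in> P" "q \<noteq> 0" "\<And>i. f i = poly p z i / poly q z i" for f p q
    unfolding K'_def frac_def using that by (intro image_eqI[of _ _ "(p, q)"]) auto
  have K'E: "\<exists>p q. p \<in> P \<and> q \<in> P \<and> q \<noteq> 0 \<and> f = (\<lambda>i. poly p z i / poly q z i)" if "f \<in> K'" for f
    using that unfolding K'_def frac_def by auto
  have one_P: "1 \<in> P" "1 \<noteq> (0 :: ('i \<Rightarrow> 'b) poly)" and zero_P: "0 \<in> P"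
    using KD(2,3) by (auto simp: P_iff coeff_1)
  have "K \<subseteq> K'"
  proof
    fix f assume f: "f \<in> K"
    have "[:f:] \<in> P"
      using f KD(2) by (auto simp: P_iff coeff_pCons split: nat.splits)
    then show "f \<in> K'"
      by (rule K'I[OF _ one_P]) simp
  qed
  moreover have "z \<in> K'"
  proof (rule K'I[OF _ one_P])
    show "[:0, 1:] \<in> P"
      using KD(2,3) by (auto simp: P_iff coeff_pCons split: nat.splits)
  qed simp
  moreover have "embedded_field E K'"
    unfolding embedded_field_def
  proof (intro conjI ballI impI allI)
    show "countable K'"
      unfolding K'_def P_def using countable_polys[OF KD(1)]
      by (intro countable_image countable_SIGMA countable_Diff) auto
    show "0 \<in> K'" "1 \<in> K'"
      using \<open>K \<subseteq> K'\<close> KD(2,3) by auto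
  next
    fix f g assume fg: "f \<in> K'" "g \<in> K'"
    obtain p q where p: "p \<in> P" "q \<in> P" "q \<noteq> 0" and f: "f = (\<lambda>i. poly p z i / poly q z i)"
      using K'E[OF fg(1)] by blast
    obtain p' q' where p': "p' \<in> P" "q' \<in> P" "q' \<noteq> 0" and g: "g = (\<lambda>i. poly p' z i / poly q' z i)"
      using K'E[OF fg(2)] by blast
    note pq = p p'
    have nz: "poly q z i \<noteq> 0" "poly q' z i \<noteq> 0" for i
      using P_nonzero pq by auto
    have qq: "q * q' \<in> P" "q * q' \<noteq> 0"
      using pq P_mult_nonzero[of q q'] by (simp_all add: P_mult)
    have "p * q' - p' * q \<in> P" "p * p' \<in> P"
      using pq by (simp_all add: P_mult P_diff)
    then show "f - g \<in> K'" "f * g \<in> K'"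
      using nz by (auto intro: K'I[OF _ qq, of "p * q' - p' * q"] K'I[OF _ qq, of "p * p'"]
          simp: f g diff_frac_eq)
  next
    fix f assume "f \<in> K'" "f \<noteq> 0"
    obtain p q where pq: "p \<in> P" "q \<in> P" "q \<noteq> 0" and f: "f = (\<lambda>i. poly p z i / poly q z i)"
      using K'E[OF \<open>f \<in> K'\<close>] by blast
    have "p \<noteq> 0"
      using \<open>f \<noteq> 0\<close> f by (auto simp: fun_eq_iff)
    then show "f i \<noteq> 0" for i
      using P_nonzero pq by (simp add: f)
    show "(\<lambda>i. inverse (f i)) \<in> K'"
      by (rule K'I[of q p]) (use pq \<open>p \<noteq> 0\<close> in \<open>auto simp: f\<close>)
  next
    fix f i assume "f \<in> K'"
    obtain p q where "p \<in> P" "q \<in> P" "f = (\<lambda>i. poly p z i / poly q z i)"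
      using K'E[OF \<open>f \<in> K'\<close>] by blast
    then show "f i \<in> E i"
      by (simp add: P_E is_subfieldD(8)[OF E])
  qed
  ultimately show ?thesis
    using that by blast
qed

section \<open>Countability and the choice of transcendental series\<close>

lemma countable_algebraic_over:
  fixes C :: "'a::idom set"
  assumes "countable C"
  shows "countable {w. \<exists>p. p \<noteq> 0 \<and> (\<forall>n. Polynomial.coeff p n \<in> C) \<and> poly p w = 0}"
proof -
  have "{w. \<exists>p. p \<noteq> 0 \<and> (\<forall>n. Polynomial.coeff p n \<in> C) \<and> poly p w = 0} =
      (\<Union>p\<in>{p. (\<forall>n. Polynomial.coeff p n \<in> C)} - {0}. {w. poly p w = 0})"
    by auto
  also have "countable \<dots>"
  proof (rule countable_UN)
    show "countable ({p. \<forall>n. Polynomial.coeff p n \<in> C} - {0})"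
      using countable_polys[OF assms] by (rule countable_Diff)
    show "countable {w. poly p w = 0}" if "p \<in> {p. \<forall>n. Polynomial.coeff p n \<in> C} - {0}" for p
      using that poly_roots_finite[of p] by (simp add: countable_finite)
  qed
  finally show ?thesis .
qed

lemma uncountable_laurent_leading_term:
  assumes S: "is_subfield S" and c: "c \<in> S" "c \<noteq> 0"
  shows "uncountable {w \<in> laurent_over S. fls_subdegree w = e \<and> w $$ e = c}" (is "uncountable ?W")
proof
  assume W: "countable ?W"
  \<comment> \<open>\<open>w A\<close> is X^e times c plus the sum of X^(m+1) over m in
    \<open>A\<close>. The leading term is fixed and \<open>A\<close> can be read off the later
    coefficients, even if \<open>S\<close> has only two elements.\<close>
  define w where "w = (\<lambda>A :: nat set. fls_shift (- e) (fps_to_fls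
      (Abs_fps (\<lambda>n. case n of 0 \<Rightarrow> c | Suc m \<Rightarrow> if m \<in> A then 1 else 0))))"
  have "w A \<in> ?W" for A
  proof -
    have "w A $$ e = c" "\<And>k. k < e \<Longrightarrow> w A $$ k = 0"
      by (auto simp: w_def)
    moreover from this have "fls_subdegree (w A) = e"
      using c by (intro fls_subdegree_eqI) auto
    moreover have "w A \<in> laurent_over S"
      using is_subfieldD(1,2)[OF S] c by (auto simp: w_def laurent_over_def split: nat.splits)
    ultimately show ?thesis
      by simp
  qed
  then have "countable (range w)"
    using W by (meson countable_subset image_subsetI)
  moreover have "inj w"
  proof (rule injI, rule Set.set_eqI)
    fix A B and m :: nat assume "w A = w B"
    then have "w A $$ (e + 1 + int m) = w B $$ (e + 1 + int m)"
      by simp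
    moreover have "nat (1 + int m) = Suc m"
      by simp
    ultimately show "m \<in> A \<longleftrightarrow> m \<in> B"
      by (simp add: w_def split: if_splits)
  qed
  ultimately have "countable (UNIV :: nat set set)"
    using countable_image_inj_on by blast
  then have "range (from_nat_into (UNIV :: nat set set)) = Pow UNIV"
    by (simp add: range_from_nat_into)
  then show False
    using Cantors_theorem by blast
qed

text \<open>One family is adjoined for each element of \<open>T\<close>; earlier families survive
  because the fields only grow.\<close>

lemma ex_embedded_field_with_leading_terms:
  fixes L :: "'i \<Rightarrow> 'a::field set"
  assumes K: "embedded_field (\<lambda>i. laurent_over (L i)) K" and L: "\<And>i. is_subfield (L i)"
    and "finite T" and T: "\<And>e c i. (e, c) \<in> T \<Longrightarrow> c i \<in> L i \<and> c i \<noteq> 0"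
  shows "\<exists>K'. embedded_field (\<lambda>i. laurent_over (L i)) K' \<and>
    (\<forall>(e, c)\<in>T. \<exists>z\<in>K'. \<forall>i. fls_subdegree (z i) = e i \<and> z i $$ e i = c i)"
  using \<open>finite T\<close> T
proof (induction T rule: finite_induct)
  case empty
  then show ?case
    using K by auto
next
  case (insert t T)
  obtain e c where t: "t = (e, c)"
    by (cases t)
  have "\<exists>K'. embedded_field (\<lambda>i. laurent_over (L i)) K' \<and>
      (\<forall>(e, c)\<in>T. \<exists>z\<in>K'. \<forall>i. fls_subdegree (z i) = e i \<and> z i $$ e i = c i)"
    by (rule insert.IH) (use insert.prems in blast)
  then obtain K1 where K1: "embedded_field (\<lambda>i. laurent_over (L i)) K1"
    and T1: "\<forall>(e, c)\<in>T. \<exists>z\<in>K1. \<forall>i. fls_subdegree (z i) = e i \<and> z i $$ e i = c i"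
    by auto
  \<comment> \<open>The components of the new family can be chosen independently: each only has to
    avoid the countable set \<open>A i\<close> of elements algebraic over the projection of
    \<open>K1\<close> to that component.\<close>
  define A where "A = (\<lambda>i. {w. \<exists>p. p \<noteq> 0 \<and> (\<forall>n. Polynomial.coeff p n \<in> (\<lambda>f. f i) ` K1) \<and> poly p w = 0})"
  define W where "W = (\<lambda>i. {w \<in> laurent_over (L i). fls_subdegree w = e i \<and> w $$ e i = c i})"
  have "\<exists>w. w \<in> W i - A i" for i
  proof -
    have "uncountable (W i)"
      unfolding W_def using insert.prems[of e c i] t by (intro uncountable_laurent_leading_term L) auto
    moreover have "countable (A i)"
      unfolding A_def using embedded_fieldD(1)[OF K1] by (intro countable_algebraic_over) simp
    ultimately have "W i - A i \<noteq> {}"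
      by (metis Diff_eq_empty_iff countable_subset)
    then show ?thesis
      by blast
  qed
  then obtain z where z: "\<And>i. z i \<in> W i - A i"
    by metis
  obtain K2 where K2: "embedded_field (\<lambda>i. laurent_over (L i)) K2" "K1 \<subseteq> K2" "z \<in> K2"
  proof (rule adjoin_transcendental[OF K1])
    show "is_subfield (laurent_over (L i))" for i
      by (rule is_subfield_laurent_over[OF L])
    show "z i \<in> laurent_over (L i)" for i
      using z[of i] by (simp add: W_def)
    show "poly p (z i) \<noteq> 0" if "p \<noteq> 0" "(\<forall>n. Polynomial.coeff p n \<in> (\<lambda>f. f i) ` K1)" for i p
      using z[of i] that by (auto simp: A_def)
  qed
  have "\<forall>i. fls_subdegree (z i) = e i \<and> z i $$ e i = c i"
    using z by (simp add: W_def)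
  moreover have "\<exists>z\<in>K2. \<forall>i. fls_subdegree (z i) = e' i \<and> z i $$ e' i = c' i" if "(e', c') \<in> T" for e' c'
    using T1 that K2(2) by blast
  ultimately show ?case
    unfolding t using K2(1,3) by (intro exI[of _ K2]) blast
qed

section \<open>The order cut out by residue subfields\<close>

lemma fls_times_nth_0:
  fixes f g :: "'a::semiring_1 fls"
  assumes "fls_subdegree f \<ge> 0" "fls_subdegree g \<ge> 0"
  shows "(f * g) $$ 0 = f $$ 0 * g $$ 0"
proof -
  have "fls_regpart (f * g) $ 0 = (fls_regpart f * fls_regpart g) $ 0"
    by (simp only: fls_times_conv_regpart[OF assms])
  then show ?thesis
    by simp
qed

lemma fls_lead_mult:
  fixes f g :: "'a::semiring_no_zero_divisors fls"
  assumes "f \<noteq> 0" "g \<noteq> 0"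
  shows "(f * g) $$ fls_subdegree (f * g) = f $$ fls_subdegree f * g $$ fls_subdegree g"
  using assms by simp

text \<open>The start of the chain of extensions: \<open>P\<close> is embedded diagonally by
  constant series.\<close>

lemma embedded_field_constants:
  fixes P :: "'a::field set" and L :: "'i \<Rightarrow> 'a set"
  assumes P: "is_subfield P" "countable P" "\<And>i. P \<subseteq> L i" and L: "\<And>i. is_subfield (L i)"
  shows "embedded_field (\<lambda>i. laurent_over (L i)) ((\<lambda>c _. fls_const c) ` P)"
  unfolding embedded_field_def
proof (intro conjI ballI impI allI)
  note PD = is_subfieldD[OF P(1)]
  let ?K = "(\<lambda>c (_ :: 'i). fls_const c) ` P"
  show "countable ?K"
    using P(2) by simp
  show "0 \<in> ?K"
    by (rule image_eqI[OF _ PD(1)]) (simp add: fun_eq_iff)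
  show "1 \<in> ?K"
    by (rule image_eqI[OF _ PD(2)]) (simp add: fun_eq_iff)
  show "f - g \<in> ?K" "f * g \<in> ?K" if fg: "f \<in> ?K" "g \<in> ?K" for f g
  proof -
    obtain c d where "c \<in> P" "d \<in> P" "f = (\<lambda>_. fls_const c)" "g = (\<lambda>_. fls_const d)"
      using fg by blast
    then show "f - g \<in> ?K" "f * g \<in> ?K"
      using PD(3,4)[of c d]
      by (auto intro: image_eqI[of _ _ "c - d"] image_eqI[of _ _ "c * d"]
          simp: fun_eq_iff fls_minus_const fls_const_mult_const)
  qed
  fix f :: "'i \<Rightarrow> 'a fls" and i assume "f \<in> ?K"
  then obtain c where c: "c \<in> P" "f = (\<lambda>_. fls_const c)"
    by blast
  then show "f i \<in> laurent_over (L i)"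
    using P(3)[of i] is_subfieldD(1)[OF L] by (auto simp: laurent_over_def)
  assume "f \<noteq> 0"
  then have "c \<noteq> 0"
    using c(2) by auto
  then show "f i \<noteq> 0"
    using c by (simp add: fls_const_nonzero)
  show "(\<lambda>i. inverse (f i)) \<in> ?K"
    using c PD(5)[of c] by (auto intro!: image_eqI[of _ _ "inverse c"] simp: fls_inverse_const)
qed

text \<open>The elements of \<open>K\<close> that lie in k_i + X L_i[[X]] for all i in
  \<open>I\<close>; that the coefficients lie in L_i is part of
  \<open>embedded_field\<close>.\<close>

definition order_ring :: "('i \<Rightarrow> 'a fls) set \<Rightarrow> 'i set \<Rightarrow> ('i \<Rightarrow> 'a set) \<Rightarrow> ('i \<Rightarrow> 'a::field fls) ring" where
  "order_ring K I k = \<lparr>carrier = {f \<in> K. \<forall>i\<in>I. fls_subdegree (f i) \<ge> 0 \<and> f i $$ 0 \<in> k i},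
    monoid.mult = (*), one = 1, ring.zero = 0, add = (+)\<rparr>"

lemma domain_order_ring:
  fixes K :: "('i \<Rightarrow> 'a::field fls) set"
  assumes K: "embedded_field E K" and k: "\<And>i. is_subfield (k i)"
  shows "domain (order_ring K I k)"
proof -
  note KD = embedded_fieldD[OF K]
  note kD = is_subfieldD[OF k]
  let ?R = "order_ring K I k"
  have add: "f + g \<in> carrier ?R" if "f \<in> carrier ?R" "g \<in> carrier ?R" for f g
  proof -
    have "fls_subdegree (f i + g i) \<ge> 0" if "i \<in> I" for i
    proof -
      have "fls_subdegree (f i) \<ge> 0" "fls_subdegree (g i) \<ge> 0"
        using \<open>f \<in> carrier ?R\<close> \<open>g \<in> carrier ?R\<close> that by (simp_all add: order_ring_def)
      then show ?thesis
        by (intro fls_subdegree_ge0I) simp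
    qed
    then show ?thesis
      using that KD(6) kD(7) by (simp add: order_ring_def)
  qed
  have mult: "f * g \<in> carrier ?R" if "f \<in> carrier ?R" "g \<in> carrier ?R" for f g
    using that KD(5) kD(4) by (simp add: order_ring_def fls_times_nth_0 fls_mult_subdegree_ge_0)
  have one: "1 \<in> carrier ?R" and zero: "0 \<in> carrier ?R"
    using KD(2,3) kD(1,2) by (simp_all add: order_ring_def)
  have uminus: "- f \<in> carrier ?R" if "f \<in> carrier ?R" for f
    using that KD(4)[OF KD(2), of f] kD(6) by (simp add: order_ring_def)
  have ops: "x \<otimes>\<^bsub>?R\<^esub> y = x * y" "x \<oplus>\<^bsub>?R\<^esub> y = x + y" "\<one>\<^bsub>?R\<^esub> = 1" "\<zero>\<^bsub>?R\<^esub> = 0" for x y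
    by (simp_all add: order_ring_def)
  have "cring ?R"
  proof (intro cringI abelian_groupI comm_monoidI)
    show "\<exists>y\<in>carrier ?R. y \<oplus>\<^bsub>?R\<^esub> x = \<zero>\<^bsub>?R\<^esub>" if "x \<in> carrier ?R" for x
      using uminus[OF that] by (intro bexI[of _ "- x"]) (simp_all add: ops)
  qed (simp_all add: ops add mult one zero algebra_simps)
  \<comment> \<open>Families in general have zero divisors, but a nonzero element of
    \<open>K\<close> is nonzero in every component.\<close>
  moreover have "a = 0 \<or> b = 0" if "a * b = 0" "a \<in> carrier ?R" "b \<in> carrier ?R" for a b
  proof (rule ccontr)
    assume "\<not> (a = 0 \<or> b = 0)"
    then have "a i \<noteq> 0" "b i \<noteq> 0" for i
      using that KD(7) by (simp_all add: order_ring_def)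
    then have "(a * b) i \<noteq> 0" for i
      by simp
    then show False
      using that(1) by simp
  qed
  ultimately show ?thesis
    by (intro domain.intro domain_axioms.intro) (simp_all add: ops)
qed

text \<open>The power map \<open>x \<mapsto> x ^ e i\<close> on \<open>L\<^sub>i\<^sup>\<times>\<close> has kernel \<open>k\<^sub>i\<^sup>\<times>\<close>, so its image stands for the quotient
  group.\<close>

theorem ex_primefree_CK_domain:
  fixes L k :: "nat \<Rightarrow> 'a::field set" and e :: "nat \<Rightarrow> nat" and N :: nat
  assumes "N > 0" and L: "\<And>i. is_subfield (L i)" "\<And>i. finite (L i)"
    and k: "\<And>i. is_subfield (k i)"
    and k_iff: "\<And>i x. \<lbrakk>x \<in> L i; x \<noteq> 0\<rbrakk> \<Longrightarrow> x \<in> k i \<longleftrightarrow> x ^ e i = 1"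
    and P: "is_subfield P" "\<And>i. P \<subseteq> L i"
    and card: "\<And>i. card ((\<lambda>x. x ^ e i) ` (L i - {0})) \<ge> 2"
  shows "\<exists>R :: complex ring. CK_domain (\<Sum>i<N. card ((\<lambda>x. x ^ e i) ` (L i - {0}))) R \<and> primefree R"
proof -
  let ?G = "\<lambda>i. (\<lambda>x. x ^ e i) ` (L i - {0})"
  note kD = is_subfieldD[OF k]
  \<comment> \<open>The prescribed leading terms of the uniformizers: c X at the place
    \<open>i\<close>, and 1 at every other place, since 1 lies in each \<open>k j\<close>.\<close>
  define T where "T = (\<lambda>(i :: nat, c). (\<lambda>j. if j = i then 1 else 0 :: int, \<lambda>j. if j = i then c else 1)) `
      (SIGMA i:{..<N}. L i - {0})"
  have "finite T"
    unfolding T_def using L(2) by (intro finite_imageI finite_SigmaI) auto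
  have "countable P"
    using P(2)[of 0] L(2)[of 0] by (meson countable_finite finite_subset)
  then have K0: "embedded_field (\<lambda>i. laurent_over (L i)) ((\<lambda>c _. fls_const c) ` P)"
    by (intro embedded_field_constants P L(1))
  have T: "c i \<in> L i \<and> c i \<noteq> 0" if "(d, c) \<in> T" for d c i
    using that is_subfieldD(2)[OF L(1)] by (auto simp: T_def split: if_splits)
  have "\<exists>K. embedded_field (\<lambda>i. laurent_over (L i)) K \<and>
      (\<forall>(e, c)\<in>T. \<exists>z\<in>K. \<forall>i. fls_subdegree (z i) = e i \<and> z i $$ e i = c i)"
    by (rule ex_embedded_field_with_leading_terms[OF K0 L(1) \<open>finite T\<close>]) (rule T)
  then obtain K where K: "embedded_field (\<lambda>i. laurent_over (L i)) K"
    and lead: "\<And>d c. (d, c) \<in> T \<Longrightarrow> \<exists>z\<in>K. \<forall>i. fls_subdegree (z i) = d i \<and> z i $$ d i = c i"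
    by blast
  note KD = embedded_fieldD[OF K]
  let ?R = "order_ring K {..<N} k"
  let ?lead = "\<lambda>f. f $$ fls_subdegree f"
  interpret domain ?R
    by (rule domain_order_ring[OF K k])
  have ops: "x \<otimes>\<^bsub>?R\<^esub> y = x * y" "\<zero>\<^bsub>?R\<^esub> = 0" for x y
    by (simp_all add: order_ring_def)
  have carrier: "f \<in> carrier ?R \<longleftrightarrow> f \<in> K \<and> (\<forall>i<N. fls_subdegree (f i) \<ge> 0 \<and> f i $$ 0 \<in> k i)" for f
    by (auto simp: order_ring_def)
  have nz: "f i \<noteq> 0" if "f \<in> carrier ?R - {\<zero>\<^bsub>?R\<^esub>}" for f i
    using that KD(7) by (simp add: carrier ops)
  have lead_L: "?lead (f i) \<in> L i - {0}" if "f \<in> K" "f i \<noteq> 0" for f i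
    using KD(9)[OF that(1), of i] that(2) by (auto simp: laurent_over_def)
  interpret graded_residues ?R "{..<N}" "\<lambda>i f. nat (fls_subdegree (f i))" "\<lambda>i f. ?lead (f i) ^ e i" ?G
  proof (unfold_locales, goal_cases)
    case (5 i a b)
    then show ?case
      using nz[OF 5(2), of i] nz[OF 5(3), of i] by (simp add: ops carrier nat_add_distrib)
  next
    case (6 i a b)
    then show ?case
      using nz[OF 6(2), of i] nz[OF 6(3), of i] by (simp add: ops fls_lead_mult power_mult_distrib)
  next
    case (7 i a)
    then show ?case
      using lead_L[of a i] nz[OF 7(2), of i] by (auto simp: carrier)
  next
    case (8 i a)
    then have "fls_subdegree (a i) = 0" "a i $$ 0 \<in> k i"
      by (auto simp: carrier)
    then show ?case
      using k_iff[of "?lead (a i)" i] lead_L[of a i] nz[OF 8(2), of i] 8(2) by (auto simp: carrier)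
  next
    case (9 a b)
    define c where "c = (\<lambda>i. a i * inverse (b i))"
    have c_eq: "c = a * (\<lambda>i. inverse (b i))"
      by (simp add: c_def fun_eq_iff)
    have "(\<lambda>i. inverse (b i)) \<in> K"
      using 9(2) KD(8) by (simp add: carrier ops)
    then have cK: "c \<in> K"
      unfolding c_eq using 9(1) KD(5) by (simp add: carrier)
    have abc: "a i = b i * c i" for i
      using nz[OF 9(2), of i] by (simp add: c_def)
    have cnz: "c i \<noteq> 0" for i
      using nz[OF 9(1), of i] abc[of i] by auto
    have "fls_subdegree (c i) \<ge> 0 \<and> c i $$ 0 \<in> k i" if i: "i < N" for i
    proof -
      have deg: "fls_subdegree (a i) = fls_subdegree (b i) + fls_subdegree (c i)"
        using nz[OF 9(2), of i] cnz by (simp add: abc)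
      have pos: "fls_subdegree (a i) \<ge> 0" "fls_subdegree (b i) \<ge> 0"
        using 9(1,2) i by (auto simp: carrier)
      \<comment> \<open>Positive order makes the constant term 0. At order 0 the constant term is
        the quotient of the leading coefficients, and equal classes put it into the kernel of the
        power map, that is, into \<open>k i\<close>.\<close>
      consider "fls_subdegree (c i) > 0" | "fls_subdegree (c i) = 0" "?lead (a i) ^ e i = ?lead (b i) ^ e i"
        using 9(3)[of i] i deg pos by fastforce
      then show ?thesis
      proof cases
        case 1
        then show ?thesis
          using kD(1) by simp
      next
        case 2
        have "?lead (a i) = ?lead (b i) * ?lead (c i)"
          using fls_lead_mult[OF nz[OF 9(2)] cnz, of i i] by (simp add: abc)
        then have "?lead (c i) ^ e i = 1"
          using 2(2) nz[OF 9(2), of i] by (simp add: power_mult_distrib)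
        then show ?thesis
          using k_iff[of "?lead (c i)" i] lead_L[OF cK cnz, of i] 2(1) by simp
      qed
    qed
    then have "c \<in> carrier ?R"
      using cK by (simp add: carrier)
    then show ?case
      using abc by (intro bexI[of _ c]) (auto simp: ops fun_eq_iff)
  next
    case (10 i g)
    then obtain c where c: "c \<in> L i - {0}" "g = c ^ e i"
      by blast
    then have "(\<lambda>j. if j = i then 1 else 0, \<lambda>j. if j = i then c else 1) \<in> T"
      unfolding T_def using 10(1) by (intro image_eqI[of _ _ "(i, c)"]) auto
    from lead[OF this] obtain z where z: "z \<in> K" "\<And>j. fls_subdegree (z j) = (if j = i then 1 else 0)"
        "\<And>j. z j $$ (if j = i then 1 else 0) = (if j = i then c else 1)"
      using lead by blast
    have z0: "z j $$ 0 = (if j = i then 0 else 1)" for j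
      using z(2)[of j] z(3)[of j] by (cases "j = i") simp_all
    have "z i \<noteq> 0"
      using z(2)[of i] by auto
    then have "z \<noteq> 0"
      by auto
    moreover have "z \<in> carrier ?R"
      using z(1,2) z0 kD(1,2) by (simp add: carrier)
    moreover have "z i $$ 1 = c"
      using z(3)[of i] by simp
    ultimately show ?case
      using z(2) c(2) by (intro bexI[of _ z]) (simp_all add: ops)
  qed (use \<open>N > 0\<close> L(2) card in auto)
  \<comment> \<open>Countability of \<open>K\<close> now serves a second purpose: the elements can
    be numbered and so moved into the complex numbers.\<close>
  have "countable (carrier ?R)"
    using KD(1) by (rule countable_subset[rotated]) (auto simp: carrier)
  then have "inj_on (to_nat_on (carrier ?R)) (carrier ?R)"
    by (rule inj_on_to_nat_on)
  then have "inj_on (\<lambda>x. of_nat (to_nat_on (carrier ?R) x) :: complex) (carrier ?R)"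
    by (simp add: inj_on_def)
  then show ?thesis
    using CK_domain_primefree_image_ring by blast
qed

section \<open>Finite fields inside an algebraic closure\<close>

text \<open>X^m - 1 splits, and a double root would be a root of the derivative m X^(m-1), which
  vanishes only at 0 when m is nonzero in the field.\<close>

lemma card_roots_of_unity:
  assumes m: "m > 0" "of_nat m \<noteq> (0 :: 'a::alg_closed_field)"
  shows "card {x :: 'a. x ^ m = 1} = m"
proof -
  define p :: "'a poly" where "p = Polynomial.monom 1 m - 1"
  have deg: "Polynomial.degree p = m"
    unfolding p_def diff_conv_add_uminus using m(1)
    by (subst degree_add_eq_left) (auto simp: Polynomial.degree_monom_eq)
  then have "p \<noteq> 0"
    using m(1) by auto
  have root: "poly p x = 0 \<longleftrightarrow> x ^ m = 1" for x
    by (simp add: p_def poly_monom)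
  obtain A where A: "size A = Polynomial.degree p"
      "p = Polynomial.smult (Polynomial.lead_coeff p) (\<Prod>x\<in>#A. [:-x, 1:])"
    using alg_closed_imp_factorization[OF \<open>p \<noteq> 0\<close>] by blast
  have roots: "set_mset A = {x. x ^ m = 1}"
  proof -
    have "poly p x = 0 \<longleftrightarrow> x \<in># A" for x
      by (subst A(2)) (use \<open>p \<noteq> 0\<close> in \<open>auto simp: poly_prod_mset prod_mset_zero_iff\<close>)
    then show ?thesis
      using root by blast
  qed
  have "count A x = 1" if "x \<in># A" for x
  proof (rule ccontr)
    assume "count A x \<noteq> 1"
    obtain A' where A': "A = add_mset x A'"
      using \<open>x \<in># A\<close> multi_member_split by metis
    then have "x \<in># A'"
      using \<open>count A x \<noteq> 1\<close> by (simp add: not_in_iff)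
    then obtain B where "A = add_mset x (add_mset x B)"
      using A' multi_member_split by metis
    then have "\<exists>r. p = [:-x, 1:] * ([:-x, 1:] * r)"
      using A(2) by (intro exI[of _ "Polynomial.smult (Polynomial.lead_coeff p) (\<Prod>x\<in>#B. [:-x, 1:])"])
        simp
    then obtain r where p_eq: "p = [:-x, 1:] * ([:-x, 1:] * r)"
      by blast
    have "poly (pderiv p) x = 0"
      unfolding p_eq pderiv_mult poly_add poly_mult by simp
    then have "of_nat m * x ^ (m - 1) = 0"
      by (simp add: p_def pderiv_diff pderiv_monom poly_monom)
    moreover have "x ^ m = 1"
      using that roots by auto
    ultimately show False
      using m by (auto simp: power_0_left)
  qed
  then have "size A = card (set_mset A)"
    by (simp add: size_multiset_overloaded_eq)
  then show ?thesis
    using A(1) deg roots by simp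
qed

section \<open>Finite subfields as fixed points of Frobenius powers\<close>

text \<open>For a power \<open>n\<close> of the characteristic this is the subfield with \<open>n\<close> elements.\<close>

definition fixed_by_power :: "nat \<Rightarrow> 'a::monoid_mult set" where
  "fixed_by_power n = {x. x ^ n = x}"

text \<open>Raising to a power of the characteristic respects differences, so its fixed points are
  closed under them.\<close>

lemma is_subfield_fixed_by_power:
  assumes "Factorial_Ring.prime CHAR('a::field)"
  shows "is_subfield (fixed_by_power (CHAR('a) ^ r) :: 'a set)"
proof -
  have "(x - y) ^ (CHAR('a) ^ r) = x ^ (CHAR('a) ^ r) - y ^ (CHAR('a) ^ r)" for x y :: 'a
    using freshmans_dream'[OF assms refl, of "x - y" y r] by simp
  moreover have "CHAR('a) ^ r > 0"
    using assms by (simp add: prime_gt_0_nat)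
  ultimately show ?thesis
    by (auto simp: is_subfield_def fixed_by_power_def power_mult_distrib power_inverse)
qed

lemma fixed_by_power_subset_power: "fixed_by_power n \<subseteq> fixed_by_power (n ^ r)"
  by (induction r) (auto simp: fixed_by_power_def power_mult subset_iff)

lemma fixed_by_power_iff:
  assumes "(x :: 'a::field) \<noteq> 0" "n > 0"
  shows "x \<in> fixed_by_power n \<longleftrightarrow> x ^ (n - 1) = 1"
  using assms by (cases n) (auto simp: fixed_by_power_def)

lemma finite_fixed_by_power:
  assumes "n > 1"
  shows "finite (fixed_by_power n :: 'a::field set)"
proof -
  have "Polynomial.coeff (Polynomial.monom 1 n - [:0, 1:] :: 'a poly) n = 1"
    using assms by (cases n) (auto simp: coeff_pCons split: nat.splits)
  then have "Polynomial.monom 1 n - [:0, 1 :: 'a:] \<noteq> 0"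
    by (metis coeff_0 zero_neq_one)
  moreover have "fixed_by_power n = {x :: 'a. poly (Polynomial.monom 1 n - [:0, 1:]) x = 0}"
    by (auto simp: fixed_by_power_def poly_monom)
  ultimately show ?thesis
    using poly_roots_finite by metis
qed

text \<open>The nonzero elements fixed by the power \<open>Q\<close> are the roots of unity of order
  dividing m (q - 1). Their (q - 1)-th powers are m-th roots of unity, and all of these occur
  because (q - 1)-th roots exist.\<close>

lemma power_image_fixed_by_power:
  assumes q: "q > 1" and m: "m > 0" and Q: "Q = m * (q - 1) + 1"
  shows "(\<lambda>x. x ^ (q - 1)) ` (fixed_by_power Q - {0 :: 'a::alg_closed_field}) = {y. y ^ m = 1}"
proof (intro equalityI subsetI)
  fix y :: 'a assume "y \<in> {y. y ^ m = 1}"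
  moreover obtain x :: 'a where x: "x ^ (q - 1) = y"
    using nth_root_exists[of "q - 1" y] q by auto
  ultimately have "x ^ (m * (q - 1)) = 1"
    by (simp add: mult.commute[of m] power_mult)
  moreover from this have "x \<noteq> 0"
    using m q by (auto simp: power_0_left)
  ultimately have "x \<in> fixed_by_power Q - {0}"
    using Q by (auto simp: fixed_by_power_def)
  then show "y \<in> (\<lambda>x. x ^ (q - 1)) ` (fixed_by_power Q - {0})"
    using x by blast
next
  fix y :: 'a assume "y \<in> (\<lambda>x. x ^ (q - 1)) ` (fixed_by_power Q - {0})"
  then obtain x where x: "x \<in> fixed_by_power Q" "x \<noteq> 0" "y = x ^ (q - 1)"
    by blast
  then have "x ^ (m * (q - 1)) = 1"
    using fixed_by_power_iff[of x Q] Q by simp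
  then show "y \<in> {y. y ^ m = 1}"
    using x by (simp add: mult.commute[of m] power_mult)
qed

text \<open>With p the characteristic, \<open>Q\<close> says that \<open>m i\<close> is the index of
  the unit group of the field with p^(a i) elements in that of the field with p^(b i)
  elements.\<close>

lemma ex_primefree_CK_domain_sum:
  fixes a b m :: "nat \<Rightarrow> nat"
  assumes p: "Factorial_Ring.prime CHAR('a::alg_closed_field)" and "N > 0" and ab: "\<And>i. a i > 0" "\<And>i. b i > 0"
    and m: "\<And>i. m i \<ge> 2" "\<And>i. \<not> CHAR('a) dvd m i"
    and Q: "\<And>i. CHAR('a) ^ b i = m i * (CHAR('a) ^ a i - 1) + 1"
  shows "\<exists>R :: complex ring. CK_domain (\<Sum>i<N. m i) R \<and> primefree R"
proof -
  let ?p = "CHAR('a)"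
  let ?L = "\<lambda>i. fixed_by_power (?p ^ b i) :: 'a set"
  let ?e = "\<lambda>i. ?p ^ a i - 1"
  have gt1: "?p ^ a i > 1" "?p ^ b i > 1" for i
    using one_less_power[OF prime_gt_1_nat[OF p]] ab by blast+
  have card: "card ((\<lambda>x. x ^ ?e i) ` (?L i - {0})) = m i" for i
  proof -
    have "m i > 0"
      using m(1)[of i] by simp
    moreover have "of_nat (m i) \<noteq> (0 :: 'a)"
      using m(2)[of i] by (simp add: of_nat_eq_0_iff_char_dvd)
    ultimately show ?thesis
      by (subst power_image_fixed_by_power[OF gt1(1) _ Q]) (rule card_roots_of_unity | assumption)+
  qed
  have "\<exists>R :: complex ring. CK_domain (\<Sum>i<N. card ((\<lambda>x. x ^ ?e i) ` (?L i - {0}))) R \<and> primefree R"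
  proof (rule ex_primefree_CK_domain[OF \<open>N > 0\<close>, where k = "\<lambda>i. fixed_by_power (?p ^ a i)"
        and P = "fixed_by_power (?p ^ 1)"])
    show "fixed_by_power (?p ^ 1) \<subseteq> ?L i" for i
      using fixed_by_power_subset_power[of ?p "b i"] by simp
    show "x \<in> fixed_by_power (?p ^ a i) \<longleftrightarrow> x ^ ?e i = 1" if "x \<noteq> 0" for i and x :: 'a
      using that order.strict_trans[OF zero_less_one gt1(1)] by (rule fixed_by_power_iff)
    show "2 \<le> card ((\<lambda>x. x ^ ?e i) ` (?L i - {0}))" for i
      using m(1) by (simp only: card)
  qed (use is_subfield_fixed_by_power[OF p] finite_fixed_by_power gt1(2) in blast)+
  then show ?thesis
    by (simp only: card)
qed

section \<open>The choice of finite fields for a given \<open>n\<close>\<close>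

typedef three = "{0, 1, 2 :: nat}"
  by blast

lemma CARD_three: "CARD(three) = 3"
  using type_definition.card[OF type_definition_three] by simp

text \<open>This makes \<open>three mod_ring\<close> the field with 3 elements, as
  \<open>bool mod_ring\<close> is the one with 2.\<close>

instance three :: prime_card
  by standard (simp add: CARD_three)

theorem theorem1p3:
  fixes n :: nat
  assumes "n \<ge> 3"
  shows "\<exists>R :: complex ring. CK_domain n R \<and> primefree R"
proof (cases "n = 4")
  case True
  \<comment> \<open>A single place with the pair of fields of 3 and 9 elements: 9 = 4 * (3 - 1) +
    1.\<close>
  have "\<exists>R :: complex ring. CK_domain (\<Sum>i<1::nat. 4) R \<and> primefree R"
    by (rule ex_primefree_CK_domain_sum[where 'a = "three mod_ring alg_closure"
          and a = "\<lambda>_. 1" and b = "\<lambda>_. 2"]) (simp_all add: CARD_three)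
  then show ?thesis
    using True by simp
next
  case False
  have "n mod 3 = 0 \<or> n mod 3 = 1 \<or> n mod 3 = 2"
    by auto
  \<comment> \<open>The first place contributes \<open>m0\<close>, which has the residue of
    \<open>n\<close> modulo 3; it comes from the fields with 2^a0 and 2^b0 elements.\<close>
  then obtain m0 a0 b0 where m0: "n = m0 + 3 * ((n - m0) div 3)" "m0 \<in> {3, 5, 7}" "a0 > 0" "b0 > 0"
      "2 ^ b0 = m0 * (2 ^ a0 - 1) + 1"
  proof (elim disjE)
    assume n: "n mod 3 = 0"
    show ?thesis
    proof (rule that[of 3 1 2])
      show "n = 3 + 3 * ((n - 3) div 3)"
        using assms n by presburger
    qed simp_all
  next
    assume n: "n mod 3 = 1"
    show ?thesis
    proof (rule that[of 7 1 3])
      show "n = 7 + 3 * ((n - 7) div 3)"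
        \<comment> \<open>Excluding 4 leaves n at least 7 in this residue class, so the subtraction
          is not truncated.\<close>
        using assms n False by presburger
    qed simp_all
  next
    assume n: "n mod 3 = 2"
    show ?thesis
    proof (rule that[of 5 2 4])
      show "n = 5 + 3 * ((n - 5) div 3)"
        using assms n by presburger
    qed simp_all
  qed
  define N where "N = (n - m0) div 3"
  \<comment> \<open>Each of the \<open>N\<close> further places uses the fields with 2 and 4
    elements and adds 3 atoms.\<close>
  define m where "m = (\<lambda>i :: nat. if i = 0 then m0 else 3)"
  have "\<exists>R :: complex ring. CK_domain (\<Sum>i<Suc N. m i) R \<and> primefree R"
  proof (rule ex_primefree_CK_domain_sum[where 'a = "bool mod_ring alg_closure"
        and a = "\<lambda>i. if i = 0 then a0 else 1" and b = "\<lambda>i. if i = 0 then b0 else 2"])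
    show "m i \<ge> 2" "\<not> CHAR(bool mod_ring alg_closure) dvd m i" for i
      using m0(2) by (auto simp: m_def)
  qed (use m0 in \<open>auto simp: m_def\<close>)
  moreover have "(\<Sum>i<Suc N. m i) = n"
    using m0(1) by (simp add: m_def N_def sum.lessThan_Suc_shift del: sum.lessThan_Suc)
  ultimately show ?thesis
    by simp
qed

end
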